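(* Let $d\ge1$, let $\{P_n\}$ be a monic $d$-OPS, let $\{Q_n\}$ be a co-recursive sequence of $\{P_n\}$, and let $A_1,\dots,A_d$ be the polynomials with $Q_n=P_n-\sum_{i=1}^dA_iP_{n-i}^{(i)}$ for all $n\ge0$. Let $r\ge0$ and $m_1,\dots,m_d>n\ge0$ be integers, with $n\ge r-1$, and put $m_0=n$. Let $R_n^{(r)}$ be the $(d+1)\times(d+1)$ determinant whose row $j$ ($0\le j\le d$) is $$\big(Q_{m_j},\ P_{m_j-r}^{(r)},\ P_{m_j-r-1}^{(r+1)},\dots,P_{m_j-r-d+1}^{(r+d-1)}\big).$$ Then $$R_n^{(0)}=(-1)^{d+1}A_d\,\det\big(P_{m_j-i}^{(i)}\big)_{0\le j,i\le d}\quad\text{if }r=0,\qquad R_n^{(r)}=Q_{r-1}\,\det\big(P_{m_j-r+1-i}^{(r-1+i)}\big)_{0\le j,i\le d}\quad\text{if }r\ge1 ,$$ where in the determinants $j$ is the row index and $i$ the column index.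
   Context: A monic $d$-OPS is given by complex numbers $\beta_n$ ($n\ge0$) and $\gamma_n^s$ ($n\ge1$, $0\le s\le d-1$) with $\gamma_n^0\ne0$ for all $n\ge1$. For $r\ge0$ the associated sequence of order $r$ is defined by $P_n^{(r)}=0$ for $n<0$, $P_0^{(r)}=1$ and $$P_{n+1}^{(r)}(x)=(x-\beta_{n+r})P_n^{(r)}(x)-\sum_{\nu=0}^{d-1}\gamma_{n+r-\nu}^{d-1-\nu}P_{n-1-\nu}^{(r)}(x),\quad n\ge0,$$ where terms with $n-1-\nu<0$ are zero; $P_n=P_n^{(0)}$. A co-recursive sequence $\{Q_n\}$ of $\{P_n\}$ is obtained by replacing, in the recurrence for $\{P_n\}$, $\beta_n$ by $\beta_n+\mu_n$ for $0\le n\le d-1$ and $\gamma_n^\nu$ by $\gamma_n^\nu+\eta_n^\nu$ for $1\le n\le\nu$, $1\le\nu\le d-1$ (arbitrary complex $\mu_n,\eta_n^\nu$), all other coefficients being unchanged. There are unique polynomials $A_1,\dots,A_d$, independent of $n$, with $Q_n=P_n-\sum_{i=1}^dA_iP_{n-i}^{(i)}$ for all $n\ge0$. *)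

theory Defs
  imports "HOL-Computational_Algebra.Polynomial" "Jordan_Normal_Form.Determinant"
begin

text \<open>
  A monic d-OPS is given by its recurrence coefficients: \<open>\<beta> n\<close> for \<open>n \<ge> 0\<close> and
  \<open>\<gamma> n s\<close> (subscript \<open>n \<ge> 1\<close>, superscript \<open>s \<le> d - 1\<close>). The values of \<open>\<gamma>\<close> at other
  arguments are irrelevant: where the truncated subtraction in the subscript below
  matters, the polynomial that is multiplied has a negative index and hence is zero.

  \<open>assoc_seq d \<beta> \<gamma> r k\<close> is the polynomial with index \<open>k\<close> of the associated sequence
  of order \<open>r\<close>, for an arbitrary integer \<open>k\<close>; the sequence itself is \<open>r = 0\<close>.
  See \<open>assoc_seq_rec\<close> for the recurrence in its usual form.
\<close>

function assoc_seq ::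
  "nat \<Rightarrow> (nat \<Rightarrow> complex) \<Rightarrow> (nat \<Rightarrow> nat \<Rightarrow> complex) \<Rightarrow> nat \<Rightarrow> int \<Rightarrow> complex poly" where
  "assoc_seq d \<beta> \<gamma> r k =
    (if k < 0 then 0
     else if k = 0 then 1
     else [:- \<beta> (nat (k - 1) + r), 1:] * assoc_seq d \<beta> \<gamma> r (k - 1)
       - (\<Sum>\<nu><d. smult (\<gamma> (nat (k - 1) + r - \<nu>) (d - 1 - \<nu>))
                       (assoc_seq d \<beta> \<gamma> r (k - 2 - int \<nu>))))"
  by pat_completeness auto
termination
  by (relation "Wellfounded.measure (\<lambda>(d, \<beta>, \<gamma>, r, k). nat k)") auto

declare assoc_seq.simps [simp del]

lemma assoc_seq_neg: "k < 0 \<Longrightarrow> assoc_seq d \<beta> \<gamma> r k = 0"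
  by (simp add: assoc_seq.simps)

lemma assoc_seq_0: "assoc_seq d \<beta> \<gamma> r 0 = 1"
  by (simp add: assoc_seq.simps)

lemma assoc_seq_rec:
  "assoc_seq d \<beta> \<gamma> r (int n + 1) =
     [:- \<beta> (n + r), 1:] * assoc_seq d \<beta> \<gamma> r (int n)
     - (\<Sum>\<nu><d. smult (\<gamma> (n + r - \<nu>) (d - 1 - \<nu>)) (assoc_seq d \<beta> \<gamma> r (int n - 1 - int \<nu>)))"
  by (subst assoc_seq.simps) simp

definition corec_beta ::
  "nat \<Rightarrow> (nat \<Rightarrow> complex) \<Rightarrow> (nat \<Rightarrow> complex) \<Rightarrow> nat \<Rightarrow> complex" where
  "corec_beta d \<beta> \<mu> n = (if n \<le> d - 1 then \<beta> n + \<mu> n else \<beta> n)"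

definition corec_gamma ::
  "nat \<Rightarrow> (nat \<Rightarrow> nat \<Rightarrow> complex) \<Rightarrow> (nat \<Rightarrow> nat \<Rightarrow> complex) \<Rightarrow> nat \<Rightarrow> nat \<Rightarrow> complex" where
  "corec_gamma d \<gamma> \<eta> n \<nu> =
    (if 1 \<le> n \<and> n \<le> \<nu> \<and> 1 \<le> \<nu> \<and> \<nu> \<le> d - 1 then \<gamma> n \<nu> + \<eta> n \<nu> else \<gamma> n \<nu>)"

definition corecursive_seq ::
  "nat \<Rightarrow> (nat \<Rightarrow> complex) \<Rightarrow> (nat \<Rightarrow> nat \<Rightarrow> complex) \<Rightarrow> (nat \<Rightarrow> complex) \<Rightarrow>
   (nat \<Rightarrow> nat \<Rightarrow> complex) \<Rightarrow> int \<Rightarrow> complex poly" where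
  "corecursive_seq d \<beta> \<gamma> \<mu> \<eta> = assoc_seq d (corec_beta d \<beta> \<mu>) (corec_gamma d \<gamma> \<eta>) 0"

text \<open>Column \<open>i \<ge> 1\<close> of the determinant below is the associated sequence of order \<open>r + (i - 1)\<close>.\<close>

definition R_det ::
  "nat \<Rightarrow> (nat \<Rightarrow> int \<Rightarrow> complex poly) \<Rightarrow> (int \<Rightarrow> complex poly) \<Rightarrow> nat \<Rightarrow> (nat \<Rightarrow> nat) \<Rightarrow> complex poly" where
  "R_det d P Q r m =
    det (mat (d + 1) (d + 1) (\<lambda>(j, i).
      if i = 0 then Q (int (m j))
      else P (r + (i - 1)) (int (m j) - int r - int (i - 1))))"

end

theory Submission
  imports Defs
begin

text \<open>
  For fixed \<open>m\<close>, the values \<open>P\<^bsub>m-s\<^esub>\<^bsup>(s)\<^esup>\<close> satisfy, besides the defining recurrence in \<open>m\<close>, a dual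
  recurrence in the order \<open>s\<close>, whose coefficients do not depend on \<open>m\<close>. With it, an expansion of
  \<open>Q\<^bsub>m\<^esub>\<close> in \<open>P\<^bsub>m-s-i\<^esub>\<^bsup>(s+i)\<^esup>\<close>, \<open>0 \<le> i \<le> d\<close>, with coefficients independent of \<open>m \<ge> s\<close>,
  can be shifted from \<open>s\<close> to \<open>s + 1\<close>, starting from the given one at \<open>s = 0\<close>. Its leading
  coefficient is \<open>Q\<^bsub>s\<^esub>\<close>, as one sees at \<open>m = s\<close>. Hence the matrix of \<open>R\<^bsub>n\<^esub>\<^bsup>(r)\<^esup>\<close> is the matrix on the
  right-hand side times a \<open>(d + 1) \<times> (d + 1)\<close> matrix with determinant \<open>Q\<^bsub>r-1\<^esub>\<close> (for \<open>r \<ge> 1\<close>) or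
  \<open>(-1)\<^bsup>d+1\<^esup> A\<^bsub>d\<^esub>\<close> (for \<open>r = 0\<close>).
\<close>

text \<open>
  The Kronecker delta makes the recurrence valid at all integers, so that sums over shifted
  indices need no case distinction.
\<close>

lemma assoc_seq_rec_int:
  assumes "k > 0 \<Longrightarrow> int M = k - 1 + int r"
  shows "assoc_seq d \<beta> \<gamma> r k = of_bool (k = 0) + [:- \<beta> M, 1:] * assoc_seq d \<beta> \<gamma> r (k - 1)
    - (\<Sum>\<nu><d. smult (\<gamma> (M - \<nu>) (d - 1 - \<nu>)) (assoc_seq d \<beta> \<gamma> r (k - 2 - int \<nu>)))"
proof (cases "k > 0")
  case True
  then have "nat (k - 1) + r = M"
    using assms by simp
  then show ?thesis
    using True by (subst assoc_seq.simps) simp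
next
  case False
  then show ?thesis
    by (cases "k = 0") (simp_all add: assoc_seq_neg assoc_seq_0)
qed

text \<open>Induction on the index: the coefficients of the recurrence in the index depend only on
  the sum of index and order, those of the dual one only on the order, so the two operations
  commute.\<close>

lemma assoc_seq_dual_rec_int:
  "assoc_seq d \<beta> \<gamma> r k = of_bool (k = 0) + [:- \<beta> r, 1:] * assoc_seq d \<beta> \<gamma> (Suc r) (k - 1)
    - (\<Sum>\<sigma><d. smult (\<gamma> (Suc r) (d - 1 - \<sigma>)) (assoc_seq d \<beta> \<gamma> (r + 2 + \<sigma>) (k - 2 - int \<sigma>)))"
proof (induction "nat k" arbitrary: k rule: less_induct)
  case less
  let ?P = "assoc_seq d \<beta> \<gamma>"
  let ?X = "\<lambda>i. [:- \<beta> i, 1:]"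
  let ?g = "\<lambda>\<sigma>. \<gamma> (Suc r) (d - 1 - \<sigma>)"
  let ?D = "\<lambda>k. ?X r * ?P (Suc r) (k - 1) - (\<Sum>\<sigma><d. smult (?g \<sigma>) (?P (r + 2 + \<sigma>) (k - 2 - int \<sigma>)))"
  show ?case
  proof (cases "k > 0")
    case False
    then show ?thesis
      by (cases "k = 0") (simp_all add: assoc_seq_neg assoc_seq_0)
  next
    case True
    define M where "M = nat (k - 1) + r"
    have M: "int M = k - 1 + int r"
      using True by (simp add: M_def)
    let ?h = "\<lambda>\<nu>. \<gamma> (M - \<nu>) (d - 1 - \<nu>)"
    \<comment> \<open>\<open>?L\<close> is one step of the recurrence in the index. It is the same
      for all pairs of order and index with sum \<open>k + r\<close>, hence for every term of
      \<open>?D k\<close>.\<close>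
    let ?L = "\<lambda>f k. ?X M * f (k - 1) - (\<Sum>\<nu><d. smult (?h \<nu>) (f (k - 2 - int \<nu>)))"
    let ?\<delta> = "\<lambda>k::int. of_bool (k = 0) :: complex poly"
    have IH: "?P r j = ?\<delta> j + ?D j" if "j < k" for j
      using less[of j] True that by (simp add: nat_less_eq_zless add_diff_eq)
    have rec: "?P s j = ?\<delta> j + ?L (?P s) j" if "j + int s = k + int r" for s j
      using assoc_seq_rec_int[of j M s] that M by (simp add: add_diff_eq)
    have "?P r k = ?L (?P r) k"
      using rec[of k r] True by simp
    also have "\<dots> = ?L (\<lambda>j. ?\<delta> j + ?D j) k"
    proof -
      have "?P r (k - 2 - int \<nu>) = ?\<delta> (k - 2 - int \<nu>) + ?D (k - 2 - int \<nu>)" for \<nu>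
        by (rule IH) simp
      then show ?thesis
        using IH[of "k - 1"] by simp
    qed
    also have "\<dots> = ?L ?\<delta> k + ?L ?D k"
      by (simp add: ring_distribs smult_add_right sum.distrib)
    \<comment> \<open>A delta survives only for \<open>k = 1\<close>, where \<open>M = r\<close>, or
      for \<open>k = 2 + int \<nu>\<close>, where \<open>M - \<nu> = Suc r\<close>; there the
      coefficients of both recurrences coincide.\<close>
    also have "?L ?\<delta> k = ?X r * ?\<delta> (k - 1) - (\<Sum>\<sigma><d. smult (?g \<sigma>) (?\<delta> (k - 2 - int \<sigma>)))"
    proof -
      have "?X M * ?\<delta> (k - 1) = ?X r * ?\<delta> (k - 1)"
        using M by (cases "k = 1") simp_all
      moreover have "smult (?h \<nu>) (?\<delta> (k - 2 - int \<nu>)) = smult (?g \<nu>) (?\<delta> (k - 2 - int \<nu>))" for \<nu>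
      proof (cases "k = 2 + int \<nu>")
        case True
        then have "M - \<nu> = Suc r"
          using M by simp
        then show ?thesis
          by simp
      qed simp
      ultimately show ?thesis
        by simp
    qed
    also have "?L ?D k = ?X r * ?L (?P (Suc r)) (k - 1)
        - (\<Sum>\<sigma><d. smult (?g \<sigma>) (?L (?P (r + 2 + \<sigma>)) (k - 2 - int \<sigma>)))"
    proof -
      have swap: "(\<Sum>\<nu><d. smult (?h \<nu>) (\<Sum>\<sigma><d. smult (?g \<sigma>) (?P (r + 2 + \<sigma>) (k - 2 - int \<nu> - 2 - int \<sigma>))))
        = (\<Sum>\<sigma><d. smult (?g \<sigma>) (\<Sum>\<nu><d. smult (?h \<nu>) (?P (r + 2 + \<sigma>) (k - 2 - int \<sigma> - 2 - int \<nu>))))"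
      proof -
        have sm: "smult a (\<Sum>\<nu><d. F \<nu>) = (\<Sum>\<nu><d. smult a (F \<nu>))" for a :: complex and F
          using sum_distrib_left[of "[:a:]" F "{..<d}"] by simp
        show ?thesis
          unfolding sm by (subst sum.swap) (simp add: mult.commute algebra_simps)
      qed
      have dist: "(\<Sum>\<nu><d. smult (a \<nu>) (F \<nu> - G \<nu>)) = (\<Sum>\<nu><d. smult (a \<nu>) (F \<nu>)) - (\<Sum>\<nu><d. smult (a \<nu>) (G \<nu>))"
        for a :: "nat \<Rightarrow> complex" and F G
        by (simp add: smult_diff_right sum_subtractf)
      have pull: "(\<Sum>\<nu><d. smult (a \<nu>) (x * F \<nu>)) = x * (\<Sum>\<nu><d. smult (a \<nu>) (F \<nu>))"
        for a :: "nat \<Rightarrow> complex" and F x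
        by (simp add: sum_distrib_left)
      have sh: "k - 1 - 2 - int \<nu> = k - 2 - int \<nu> - 1" for \<nu>
        by simp
      show ?thesis
        unfolding dist pull right_diff_distrib swap sh by (simp only: algebra_simps)
    qed
    \<comment> \<open>The deltas are the initial terms that complete each \<open>?L\<close> to a
      value of an associated sequence.\<close>
    also have "(?X r * ?\<delta> (k - 1) - (\<Sum>\<sigma><d. smult (?g \<sigma>) (?\<delta> (k - 2 - int \<sigma>))))
        + (?X r * ?L (?P (Suc r)) (k - 1)
          - (\<Sum>\<sigma><d. smult (?g \<sigma>) (?L (?P (r + 2 + \<sigma>)) (k - 2 - int \<sigma>)))) =
        ?X r * (?\<delta> (k - 1) + ?L (?P (Suc r)) (k - 1))
        - (\<Sum>\<sigma><d. smult (?g \<sigma>) (?\<delta> (k - 2 - int \<sigma>) + ?L (?P (r + 2 + \<sigma>)) (k - 2 - int \<sigma>)))"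
      by (simp only: smult_add_right sum.distrib distrib_left) simp
    also have "\<dots> = ?D k"
    proof -
      have "?\<delta> (k - 1) + ?L (?P (Suc r)) (k - 1) = ?P (Suc r) (k - 1)"
        by (rule rec[symmetric]) simp
      moreover have "?\<delta> (k - 2 - int \<sigma>) + ?L (?P (r + 2 + \<sigma>)) (k - 2 - int \<sigma>)
          = ?P (r + 2 + \<sigma>) (k - 2 - int \<sigma>)" for \<sigma>
        by (rule rec[symmetric]) simp
      ultimately show ?thesis
        by simp
    qed
    finally show ?thesis
      using True by simp
  qed
qed

text \<open>The dual recurrence trades order \<open>s\<close> for the orders \<open>s + 1\<close> to
  \<open>s + d + 1\<close>; the other terms have orders \<open>s + 1\<close> to
  \<open>s + d\<close>, so \<open>d + 1\<close> consecutive orders remain.\<close>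

lemma assoc_seq_expansion_shift:
  fixes q :: "int \<Rightarrow> complex poly"
  assumes "\<forall>k\<ge>0. q k = (\<Sum>i\<le>d. c i * assoc_seq d \<beta> \<gamma> i (k - int i))"
  shows "\<exists>c. \<forall>k\<ge>int s. q k = (\<Sum>i\<le>d. c i * assoc_seq d \<beta> \<gamma> (s + i) (k - int s - int i))"
proof (induction s)
  case 0
  then show ?case
    using assms by auto
next
  case (Suc s)
  let ?P = "assoc_seq d \<beta> \<gamma>"
  obtain c where c: "\<forall>k\<ge>int s. q k = (\<Sum>i\<le>d. c i * ?P (s + i) (k - int s - int i))"
    using Suc by blast
  \<comment> \<open>The first summand comes from the dual recurrence applied to the term of
    \<open>c 0\<close>; the second is the old coefficients moved down one place.\<close>
  define c' where "c' i =
    (if i = 0 then c 0 * [:- \<beta> s, 1:] else - smult (\<gamma> (Suc s) (d - i)) (c 0)) + (if i < d then c (Suc i) else 0)"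
    for i
  have "q k = (\<Sum>i\<le>d. c' i * ?P (Suc s + i) (k - int (Suc s) - int i))" if k: "k \<ge> int (Suc s)" for k
  proof -
    let ?p = "\<lambda>i. ?P (Suc s + i) (k - int (Suc s) - int i)"
    have "q k = (\<Sum>i\<le>d. c i * ?P (s + i) (k - int s - int i))"
      using c k by simp
    also have "\<dots> = c 0 * ?P s (k - int s) + (\<Sum>i<d. c (Suc i) * ?p i)"
      unfolding sum.atMost_shift by (simp add: algebra_simps)
    \<comment> \<open>The delta vanishes because \<open>k - int s\<close> is positive.\<close>
    also have "?P s (k - int s) = [:- \<beta> s, 1:] * ?p 0 - (\<Sum>i<d. smult (\<gamma> (Suc s) (d - Suc i)) (?p (Suc i)))"
      using k by (subst assoc_seq_dual_rec_int) (simp add: algebra_simps)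
    finally have "q k = c 0 * [:- \<beta> s, 1:] * ?p 0
        + (\<Sum>i<d. - smult (\<gamma> (Suc s) (d - Suc i)) (c 0) * ?p (Suc i)) + (\<Sum>i<d. c (Suc i) * ?p i)"
      by (simp only: sum_negf mult_minus_left mult_smult_left mult_smult_right
          right_diff_distrib sum_distrib_left mult.assoc) simp
    also have "\<dots> = (\<Sum>i\<le>d. (if i = 0 then c 0 * [:- \<beta> s, 1:] else - smult (\<gamma> (Suc s) (d - i)) (c 0)) * ?p i)
        + (\<Sum>i\<le>d. (if i < d then c (Suc i) else 0) * ?p i)"
    proof -
      have "(\<Sum>i\<le>d. (if i < d then c (Suc i) else 0) * ?p i) = (\<Sum>i<d. c (Suc i) * ?p i)"
        by (simp add: lessThan_Suc_atMost[symmetric])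
      then show ?thesis
        unfolding sum.atMost_shift by simp
    qed
    also have "\<dots> = (\<Sum>i\<le>d. c' i * ?p i)"
      by (simp only: c'_def distrib_right sum.distrib)
    finally show ?thesis .
  qed
  then show ?case
    by blast
qed

lemma assoc_seq_expansion_head:
  "(\<Sum>i\<le>d. c i * assoc_seq d \<beta> \<gamma> (s + i) (0 - int i)) = c 0"
  unfolding sum.atMost_shift by (simp add: assoc_seq_neg assoc_seq_0)

text \<open>The matrix factors through the identity with first column replaced by \<open>c\<close>,
  which is lower triangular with diagonal \<open>c 0, 1, ..., 1\<close>.\<close>

lemma det_replace_first_col:
  fixes p :: "nat \<Rightarrow> nat \<Rightarrow> 'a :: comm_ring_1"
  shows "det (mat (d + 1) (d + 1) (\<lambda>(j, i). if i = 0 then \<Sum>l\<le>d. c l * p j l else p j i)) =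
    c 0 * det (mat (d + 1) (d + 1) (\<lambda>(j, i). p j i))"
proof -
  define T where "T = mat (d + 1) (d + 1) (\<lambda>(i, l). if l = 0 then c i else of_bool (i = l))"
  let ?M = "mat (d + 1) (d + 1) (\<lambda>(j, i). p j i)"
  have "mat (d + 1) (d + 1) (\<lambda>(j, i). if i = 0 then \<Sum>l\<le>d. c l * p j l else p j i) = ?M * T"
    by (rule eq_matI)
      (auto simp: T_def scalar_prod_def atLeast0LessThan lessThan_Suc_atMost mult.commute
        if_distrib[of "\<lambda>x. _ * x"] of_bool_def cong: if_cong)
  moreover have "det T = c 0"
  proof -
    have "det T = prod_list (diag_mat T)"
      by (rule det_lower_triangular[of "d + 1"]) (auto simp: T_def)
    also have "\<dots> = (\<Prod>i\<le>d. if i = 0 then c 0 else 1)"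
      unfolding prod_list_diag_prod by (rule prod.cong) (auto simp: T_def)
    also have "\<dots> = c 0"
      by (simp add: prod.delta)
    finally show ?thesis .
  qed
  ultimately show ?thesis
    by (simp add: det_mult[of _ "d + 1"] T_def)
qed

text \<open>Here the right factor consists of the column \<open>c\<close> followed by the first
  \<open>d\<close> columns of the identity.\<close>

lemma det_drop_last_col:
  fixes p :: "nat \<Rightarrow> nat \<Rightarrow> 'a :: comm_ring_1"
  shows "det (mat (d + 1) (d + 1) (\<lambda>(j, i). if i = 0 then \<Sum>l\<le>d. c l * p j l else p j (i - 1))) =
    (-1) ^ d * c d * det (mat (d + 1) (d + 1) (\<lambda>(j, i). p j i))"
proof -
  define T where "T = mat (d + 1) (d + 1) (\<lambda>(i, l). if l = 0 then c i else of_bool (i = l - 1))"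
  let ?M = "mat (d + 1) (d + 1) (\<lambda>(j, i). p j i)"
  have T: "T \<in> carrier_mat (d + 1) (d + 1)"
    by (simp add: T_def)
  have "mat (d + 1) (d + 1) (\<lambda>(j, i). if i = 0 then \<Sum>l\<le>d. c l * p j l else p j (i - 1)) = ?M * T"
    by (rule eq_matI)
      (auto simp: T_def scalar_prod_def atLeast0LessThan lessThan_Suc_atMost mult.commute
        if_distrib[of "\<lambda>x. _ * x"] of_bool_def cong: if_cong)
  moreover have "det T = (-1) ^ d * c d"
  proof -
    \<comment> \<open>The last row of \<open>T\<close> is zero except for \<open>c d\<close> in
      column 0, and the minor there is the identity.\<close>
    have "det T = (\<Sum>l<d + 1. T $$ (d, l) * cofactor T d l)"
      by (rule laplace_expansion_row[OF T]) simp
    also have "\<dots> = (\<Sum>l\<le>d. if l = 0 then c d * cofactor T d 0 else 0)"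
      by (rule sum.cong) (auto simp: T_def)
    also have "\<dots> = c d * cofactor T d 0"
      by simp
    also have "mat_delete T d 0 = 1\<^sub>m d"
      by (rule eq_matI) (auto simp: T_def mat_delete_def)
    then have "cofactor T d 0 = (-1) ^ d"
      by (simp add: cofactor_def)
    finally show ?thesis
      by (simp add: mult.commute)
  qed
  ultimately show ?thesis
    using T by (simp add: det_mult[of _ "d + 1"])
qed

theorem theorem4p8:
  fixes d r n :: nat
    and \<beta> \<mu> :: "nat \<Rightarrow> complex"
    and \<gamma> \<eta> :: "nat \<Rightarrow> nat \<Rightarrow> complex"
    and P :: "nat \<Rightarrow> int \<Rightarrow> complex poly"
    and Q :: "int \<Rightarrow> complex poly"
    and A :: "nat \<Rightarrow> complex poly"
    and m :: "nat \<Rightarrow> nat"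
  assumes d: "d \<ge> 1"
    and regular: "\<forall>k\<ge>1. \<gamma> k 0 \<noteq> 0"
    and P: "P = assoc_seq d \<beta> \<gamma>"
    and Q: "Q = corecursive_seq d \<beta> \<gamma> \<mu> \<eta>"
    and A: "\<forall>k::nat. Q (int k) = P 0 (int k) - (\<Sum>i=1..d. A i * P i (int k - int i))"
    and n: "int n \<ge> int r - 1"
    and m0: "m 0 = n"
    and m: "\<forall>j\<in>{1..d}. m j > n"
  shows "(r = 0 \<longrightarrow>
            R_det d P Q r m =
              (-1) ^ (d + 1) * A d *
              det (mat (d + 1) (d + 1) (\<lambda>(j, i). P i (int (m j) - int i)))) \<and>
         (r \<ge> 1 \<longrightarrow>
            R_det d P Q r m =
              Q (int r - 1) *
              det (mat (d + 1) (d + 1) (\<lambda>(j, i). P (r - 1 + i) (int (m j) - int r + 1 - int i))))"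
proof -
  define c where "c i = (if i = 0 then 1 else - A i)" for i
  have Q0: "Q k = (\<Sum>i\<le>d. c i * P i (k - int i))" if "k \<ge> 0" for k
  proof -
    have "(\<Sum>i\<le>d. c i * P i (k - int i)) = P 0 k + (\<Sum>i=1..d. - A i * P i (k - int i))"
      by (simp add: atMost_atLeast0 sum.atLeast_Suc_atMost c_def)
    also have "\<dots> = Q (int (nat k))"
      using that by (subst A[rule_format]) (simp add: sum_negf)
    finally show ?thesis
      using that by simp
  qed
  show ?thesis
  proof (intro conjI impI)
    assume "r = 0"
    then have "R_det d P Q r m = det (mat (d + 1) (d + 1) (\<lambda>(j, i). if i = 0
        then \<Sum>l\<le>d. c l * P l (int (m j) - int l) else P (i - 1) (int (m j) - int (i - 1))))"
      unfolding R_det_def by (simp add: Q0 cong: if_cong)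
    also have "\<dots> = (-1) ^ d * c d * det (mat (d + 1) (d + 1) (\<lambda>(j, i). P i (int (m j) - int i)))"
      by (rule det_drop_last_col)
    \<comment> \<open>Since \<open>d \<ge> 1\<close>, \<open>c d = - A d\<close>, which supplies the
      additional sign.\<close>
    finally show "R_det d P Q r m =
        (-1) ^ (d + 1) * A d * det (mat (d + 1) (d + 1) (\<lambda>(j, i). P i (int (m j) - int i)))"
      using d by (simp add: c_def)
  next
    assume r: "r \<ge> 1"
    then have r1: "int (r - 1) = int r - 1"
      by simp
    \<comment> \<open>Starting at order \<open>r - 1\<close> makes columns 1 to \<open>d\<close> of
      both matrices agree.\<close>
    obtain c' where "\<forall>k\<ge>int (r - 1). Q k = (\<Sum>i\<le>d. c' i * P (r - 1 + i) (k - int (r - 1) - int i))"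
      using assoc_seq_expansion_shift[of Q c d \<beta> \<gamma> "r - 1"] Q0 unfolding P by blast
    moreover have "k - int (r - 1) - int i = k - int r + 1 - int i" for k i
      using r1 by simp
    ultimately have c': "Q k = (\<Sum>i\<le>d. c' i * P (r - 1 + i) (k - int r + 1 - int i))" if "k \<ge> int r - 1" for k
      using that r1 by (simp only:)
    \<comment> \<open>At \<open>k = int r - 1\<close> all terms but the first have negative
      index.\<close>
    have lead: "c' 0 = Q (int r - 1)"
      using assoc_seq_expansion_head[of c' d \<beta> \<gamma> "r - 1"] by (simp add: c' P)
    \<comment> \<open>Every row thus lies in the range where the expansion holds.\<close>
    have ge: "int (m j) \<ge> int r - 1" if "j < d + 1" for j
    proof -
      have "m j \<ge> n"
        using m m0 that by (cases "j = 0") (auto intro: less_imp_le)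
      then show ?thesis
        using n by linarith
    qed
    have "R_det d P Q r m = det (mat (d + 1) (d + 1) (\<lambda>(j, i). if i = 0
        then \<Sum>l\<le>d. c' l * P (r - 1 + l) (int (m j) - int r + 1 - int l)
        else P (r - 1 + i) (int (m j) - int r + 1 - int i)))"
      unfolding R_det_def
    proof (rule arg_cong[of _ _ det], rule cong_mat)
      fix j i
      assume "j < d + 1" "i < d + 1"
      then show "(case (j, i) of (j, i) \<Rightarrow> if i = 0 then Q (int (m j))
            else P (r + (i - 1)) (int (m j) - int r - int (i - 1))) =
          (case (j, i) of (j, i) \<Rightarrow> if i = 0
            then \<Sum>l\<le>d. c' l * P (r - 1 + l) (int (m j) - int r + 1 - int l)
            else P (r - 1 + i) (int (m j) - int r + 1 - int i))"
        using c'[OF ge] r by (simp add: of_nat_diff algebra_simps)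
    qed simp_all
    also have "\<dots> = c' 0 *
        det (mat (d + 1) (d + 1) (\<lambda>(j, i). P (r - 1 + i) (int (m j) - int r + 1 - int i)))"
      by (rule det_replace_first_col)
    finally show "R_det d P Q r m = Q (int r - 1) *
        det (mat (d + 1) (d + 1) (\<lambda>(j, i). P (r - 1 + i) (int (m j) - int r + 1 - int i)))"
      by (simp only: lead)
  qed
qed

end
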